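(* Consider any problem instance in the class $I_{\text{sub}}$, with optimal Lagrange multipliers $(\mu^*,\lambda^* )$, and let $(\hat{\mu},\hat{\lambda})$ be a prediction of these multipliers (i.e. any vector of Lagrange multipliers) such that $(\hat{\mu},\hat{\lambda}) \leq (\mu^*,\lambda^* )$ component-wise. Assume that for every $t\in\mathcal{T}$ the values $\nu^t(\hat{\mu},\hat{\lambda})$ and $\nu^t(\mu^*,\lambda^* )$ lie in the range of $\nabla f^t$. Then $$\sum_{t \in \mathcal{T}} f^t (\hat{x}^t(\hat{\mu},\hat{\lambda})) - \sum_{t \in \mathcal{T}} f^t (\hat{x}^t(\mu^*,\lambda^* )) \leq \sum_{t \in \mathcal{T}} f^t\big((\nabla f^t)^{-1}(\nu^t(\hat{\mu},\hat{\lambda}))\big) - \sum_{t \in \mathcal{T}} f^t\big((\nabla f^t)^{-1}(\nu^t(\mu^*,\lambda^* ))\big).$$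
   Context: Let $T\ge 1$ be an integer and $\mathcal{T}=\{1,\ldots,T\}$. A function $r:2^{\mathcal{T}}\to\mathbb{R}$ is submodular if $r(\mathcal{X}\cup\mathcal{Y})+r(\mathcal{X}\cap\mathcal{Y})\le r(\mathcal{X})+r(\mathcal{Y})$ for all $\mathcal{X},\mathcal{Y}\subseteq\mathcal{T}$; we assume $r(\emptyset)=0$. Its base polyhedron is $\mathcal{B}(r)=\{x\in\mathbb{R}^T : \sum_{t\in\mathcal{X}}x^t\le r(\mathcal{X})\ \forall \mathcal{X}\subset\mathcal{T},\ \sum_{t\in\mathcal{T}}x^t=r(\mathcal{T})\}$ (superscripts are indices). The class $I_{\text{sub}}$ consists of all problems $\min \sum_{t\in\mathcal{T}} f^t(x^t)$ subject to $x=(x^1,\ldots,x^T)\in\mathcal{B}(r)$, where $r$ is submodular on $\mathcal{T}$ and each $f^t$ is a real-valued increasing, strictly convex, continuously differentiable function of one real variable, defined on an interval $D^t\subseteq\mathbb{R}$ containing $\mathcal{C}^t:=[\,r(\mathcal{T})-r(\mathcal{T}\setminus\{t\}),\ r(\{t\})\,]$. Lagrange multipliers: let $\mathcal{M}=\{\mathcal{X}\subseteq\mathcal{T}: 1<|\mathcal{X}|<T\}$. A vector of Lagrange multipliers is $(\mu,\lambda)$ with $\mu=(\mu_{\mathcal{X}})_{\mathcal{X}\in\mathcal{M}}$ (for the constraints $\sum_{t\in\mathcal{X}}x^t\le r(\mathcal{X})$) and a scalar $\lambda=\lambda_{\mathcal{T}}$ (for the constraint $\sum_{t\in\mathcal{T}}x^t=r(\mathcal{T})$).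 Put $\nu^t(\mu,\lambda):=-\sum_{\mathcal{X}\in\mathcal{M}:\,\mathcal{X}\ni t}\mu_{\mathcal{X}}-\lambda_{\mathcal{T}}$. Up to an additive constant, the local Lagrangian of stage $t$ is $L^t(x^t,\mu,\lambda)=f^t(x^t)-\nu^t(\mu,\lambda)\,x^t$. Local Lagrangian solution: $x^t(\mu,\lambda)$ is the unique minimizer of $L^t(\cdot,\mu,\lambda)$ over $\mathcal{C}^t$. The multipliers $(\mu^*,\lambda^* )$ are called optimal if $(x^t(\mu^*,\lambda^* ))_{t\in\mathcal{T}}$ is an optimal solution of the problem instance; it is assumed throughout that such multipliers exist. Online solution: $\hat{x}(\mu,\lambda)=(\hat{x}^1(\mu,\lambda),\ldots,\hat{x}^T(\mu,\lambda))$ is defined recursively for $\bar t=1,\ldots,T$: $\hat{x}^{\bar t}(\mu,\lambda)$ is the unique minimizer of $L^{\bar t}(\cdot,\mu,\lambda)$ over the set $\mathcal{C}^{\bar t}_{\text{proj}}$ of all $y\in\mathbb{R}$ for which there exist $x^{\bar t+1},\ldots,x^T$ with $(\hat{x}^1(\mu,\lambda),\ldots,\hat{x}^{\bar t-1}(\mu,\lambda),y,x^{\bar t+1},\ldots,x^T)\in\mathcal{B}(r)$. $\nabla f^t$ denotes the derivative of $f^t$ on $D^t$ (one-sided at endpoints of $D^t$ that belong to it), and $(\nabla f^t)^{-1}$ is its inverse, defined on the range of $\nabla f^t$ and taking values in $D^t$. *)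

theory Defs
  imports "HOL-Analysis.Analysis"
begin

text \<open>
  Stages are the natural numbers \<open>1, \<dots>, T\<close>. A vector in \<open>\<real>\<^sup>T\<close> is represented by a function
  \<open>nat \<Rightarrow> real\<close> of which only the values on \<open>{1..T}\<close> matter; likewise only the values of a set
  function on subsets of \<open>{1..T}\<close> matter, and only the values of \<open>f t\<close> on its domain \<open>D t\<close>.
\<close>

definition submodular_on :: "'a set \<Rightarrow> ('a set \<Rightarrow> real) \<Rightarrow> bool" where
  "submodular_on S r \<longleftrightarrow> (\<forall>X Y. X \<subseteq> S \<longrightarrow> Y \<subseteq> S \<longrightarrow> r (X \<union> Y) + r (X \<inter> Y) \<le> r X + r Y)"

definition base_polyhedron :: "nat \<Rightarrow> (nat set \<Rightarrow> real) \<Rightarrow> (nat \<Rightarrow> real) set" where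
  "base_polyhedron T r =
     {x. (\<forall>X. X \<subset> {1..T} \<longrightarrow> (\<Sum>t\<in>X. x t) \<le> r X) \<and> (\<Sum>t\<in>{1..T}. x t) = r {1..T}}"

definition strictly_convex_on :: "real set \<Rightarrow> (real \<Rightarrow> real) \<Rightarrow> bool" where
  "strictly_convex_on S f \<longleftrightarrow> convex S \<and>
     (\<forall>x\<in>S. \<forall>y\<in>S. \<forall>u. x \<noteq> y \<longrightarrow> 0 < u \<longrightarrow> u < 1 \<longrightarrow>
        f ((1 - u) * x + u * y) < (1 - u) * f x + u * f y)"

text \<open>
  The derivative is taken relative to the domain, so it is one-sided at those endpoints of \<open>D\<close>
  that belong to \<open>D\<close>; \<open>deriv\<close> would look at values outside of \<open>D\<close> there.
\<close>

definition grad :: "real set \<Rightarrow> (real \<Rightarrow> real) \<Rightarrow> real \<Rightarrow> real" where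
  "grad D f x = vector_derivative f (at x within D)"

definition grad_inv :: "real set \<Rightarrow> (real \<Rightarrow> real) \<Rightarrow> real \<Rightarrow> real" where
  "grad_inv D f = inv_into D (grad D f)"

definition stage_interval :: "nat \<Rightarrow> (nat set \<Rightarrow> real) \<Rightarrow> nat \<Rightarrow> real set" where
  "stage_interval T r t = {r {1..T} - r ({1..T} - {t}) .. r {t}}"

definition I_sub ::
  "nat \<Rightarrow> (nat set \<Rightarrow> real) \<Rightarrow> (nat \<Rightarrow> real set) \<Rightarrow> (nat \<Rightarrow> real \<Rightarrow> real) \<Rightarrow> bool" where
  "I_sub T r D f \<longleftrightarrow>
     1 \<le> T \<and> r {} = 0 \<and> submodular_on {1..T} r \<and>
     (\<forall>t\<in>{1..T}. is_interval (D t) \<and> stage_interval T r t \<subseteq> D t \<and>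
        mono_on (D t) (f t) \<and> strictly_convex_on (D t) (f t) \<and>
        f t differentiable_on D t \<and> continuous_on (D t) (grad (D t) (f t)))"

definition optimal_solution ::
  "nat \<Rightarrow> (nat set \<Rightarrow> real) \<Rightarrow> (nat \<Rightarrow> real \<Rightarrow> real) \<Rightarrow> (nat \<Rightarrow> real) \<Rightarrow> bool" where
  "optimal_solution T r f x \<longleftrightarrow>
     is_arg_min (\<lambda>x. \<Sum>t\<in>{1..T}. f t (x t)) (\<lambda>x. x \<in> base_polyhedron T r) x"

definition multiplier_sets :: "nat \<Rightarrow> nat set set" where
  "multiplier_sets T = {X. X \<subseteq> {1..T} \<and> 1 < card X \<and> card X < T}"

text \<open>
  Multipliers are given by \<open>\<mu> :: nat set \<Rightarrow> real\<close>, which matters only on \<open>multiplier_sets T\<close>,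
  and the scalar \<open>\<lambda>\<close>, written \<open>l\<close>. No sign is imposed on either of them.
\<close>

definition nu :: "nat \<Rightarrow> (nat set \<Rightarrow> real) \<Rightarrow> real \<Rightarrow> nat \<Rightarrow> real" where
  "nu T \<mu> l t = - (\<Sum>X\<in>{X\<in>multiplier_sets T. t \<in> X}. \<mu> X) - l"

definition local_lagrangian ::
  "nat \<Rightarrow> (nat \<Rightarrow> real \<Rightarrow> real) \<Rightarrow> (nat set \<Rightarrow> real) \<Rightarrow> real \<Rightarrow> nat \<Rightarrow> real \<Rightarrow> real" where
  "local_lagrangian T f \<mu> l t y = f t y - nu T \<mu> l t * y"

definition local_solution ::
  "nat \<Rightarrow> (nat set \<Rightarrow> real) \<Rightarrow> (nat \<Rightarrow> real \<Rightarrow> real) \<Rightarrow> (nat set \<Rightarrow> real) \<Rightarrow> real \<Rightarrow> nat \<Rightarrow> real" where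
  "local_solution T r f \<mu> l t =
     (THE y. is_arg_min (local_lagrangian T f \<mu> l t) (\<lambda>y. y \<in> stage_interval T r t) y)"

definition optimal_multipliers ::
  "nat \<Rightarrow> (nat set \<Rightarrow> real) \<Rightarrow> (nat \<Rightarrow> real \<Rightarrow> real) \<Rightarrow> (nat set \<Rightarrow> real) \<Rightarrow> real \<Rightarrow> bool" where
  "optimal_multipliers T r f \<mu> l \<longleftrightarrow> optimal_solution T r f (local_solution T r f \<mu> l)"

text \<open>
  \<open>p\<close> supplies the decisions already fixed at the stages before \<open>t\<close>; its other values are
  irrelevant.
\<close>

definition proj_set :: "nat \<Rightarrow> (nat set \<Rightarrow> real) \<Rightarrow> nat \<Rightarrow> (nat \<Rightarrow> real) \<Rightarrow> real set" where
  "proj_set T r t p = {y. \<exists>x\<in>base_polyhedron T r. (\<forall>s\<in>{1..<t}. x s = p s) \<and> x t = y}"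

lemma proj_set_cong [fundef_cong]:
  assumes "T = T'" "r = r'" "t = t'" "\<And>s. s \<in> {1..<t'} \<Longrightarrow> p s = q s"
  shows "proj_set T r t p = proj_set T' r' t' q"
  using assms by (simp add: proj_set_def)

fun online_solution ::
  "nat \<Rightarrow> (nat set \<Rightarrow> real) \<Rightarrow> (nat \<Rightarrow> real \<Rightarrow> real) \<Rightarrow> (nat set \<Rightarrow> real) \<Rightarrow> real \<Rightarrow> nat \<Rightarrow> real" where
  "online_solution T r f \<mu> l t =
     (THE y. is_arg_min (local_lagrangian T f \<mu> l t)
        (\<lambda>y. y \<in> proj_set T r t (\<lambda>s. online_solution T r f \<mu> l s)) y)"

declare online_solution.simps [simp del]

end

theory Submission
  imports Defs
begin

text \<open>
  The inequality holds stage by stage. Write \<open>x\<close> for the online solution under the prediction, \<open>z\<close>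
  for the one under the optimal multipliers (which is the local solution, as that is feasible), and
  \<open>b t \<le> a t\<close> for the unconstrained minimizers of the optimal and the predicted local Lagrangian.
  If \<open>x t \<le> z t\<close>, monotonicity of \<open>f t\<close> suffices. If \<open>z t < x t\<close>, then \<open>z t\<close> is not at the upper
  end of its interval, so \<open>b t \<le> z t\<close>, and it remains to see that \<open>x t \<le> a t\<close>.

  Otherwise \<open>x t\<close> is the least value still feasible. An exchange argument then gives a tight set
  avoiding \<open>t\<close> and containing all later stages; let \<open>A\<close> be the largest tight set avoiding \<open>t\<close>. An
  earlier stage \<open>s\<close> with \<open>x s < z s\<close> has \<open>x s < a s\<close>, so \<open>x s\<close> is the greatest feasible value
  and \<open>s\<close> lies in a tight subset of \<open>{1..s}\<close>, hence in \<open>A\<close>. So \<open>z \<le> x\<close> on the stages outside of \<open>A\<close>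
  other than \<open>t\<close>, whereas \<open>z\<close> sums to at most \<open>r A\<close>, the sum of \<open>x\<close>, over \<open>A\<close>; since \<open>x\<close> and \<open>z\<close>
  have the same total, \<open>x t \<le> z t\<close>.
\<close>

section \<open>Convexity and compactness of the projected feasible sets\<close>

lemma compact_PiE_UNIV:
  fixes S :: "'i \<Rightarrow> 'b::topological_space set"
  assumes "\<And>i. compact (S i)"
  shows "compact (PiE UNIV S)"
proof -
  have "compactin (product_topology (\<lambda>i. euclidean) UNIV) (PiE UNIV S)"
    unfolding compactin_PiE using assms by simp
  then show ?thesis unfolding euclidean_product_topology by simp
qed

text \<open>The equality for the full set contains the inequality there, so proper and improper
  subsets can be treated alike.\<close>

lemma base_polyhedron_iff:
  "x \<in> base_polyhedron T r \<longleftrightarrow>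
     (\<forall>X\<subseteq>{1..T}. sum x X \<le> r X) \<and> sum x {1..T} = r {1..T}"
  unfolding base_polyhedron_def psubset_eq by (simp only: mem_Collect_eq) (metis order_refl)

lemma proj_setI:
  "x \<in> base_polyhedron T r \<Longrightarrow> (\<And>s. s \<in> {1..<t} \<Longrightarrow> x s = p s) \<Longrightarrow> x t \<in> proj_set T r t p"
  unfolding proj_set_def by blast

lemma convex_proj_set: "convex (proj_set T r t p)"
proof (rule convexI)
  fix y z u v :: real
  assume y: "y \<in> proj_set T r t p" and z: "z \<in> proj_set T r t p"
    and u: "0 \<le> u" and v: "0 \<le> v" and uv: "u + v = 1"
  obtain a where a: "a \<in> base_polyhedron T r" "\<forall>s\<in>{1..<t}. a s = p s" "a t = y"
    using y by (auto simp: proj_set_def)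
  obtain b where b: "b \<in> base_polyhedron T r" "\<forall>s\<in>{1..<t}. b s = p s" "b t = z"
    using z by (auto simp: proj_set_def)
  let ?c = "\<lambda>i. u * a i + v * b i"
  have S: "sum ?c X = u * sum a X + v * sum b X" for X
    by (simp add: sum.distrib sum_distrib_left)
  have uvw: "u * w + v * w = w" for w using uv by (metis distrib_right mult_1)
  have "?c \<in> base_polyhedron T r"
    unfolding base_polyhedron_iff S
  proof safe
    fix X assume X: "X \<subseteq> {1..T}"
    have "u * sum a X + v * sum b X \<le> u * r X + v * r X"
      using a(1) b(1) X u v by (intro add_mono mult_left_mono) (auto simp: base_polyhedron_iff)
    then show "u * sum a X + v * sum b X \<le> r X" using uvw by simp
  next
    show "u * sum a {1..T} + v * sum b {1..T} = r {1..T}"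
      using a(1) b(1) uvw by (simp add: base_polyhedron_iff)
  qed
  moreover have "\<forall>s\<in>{1..<t}. ?c s = p s" using a b uvw by simp
  ultimately show "u *\<^sub>R y + v *\<^sub>R z \<in> proj_set T r t p"
    using proj_setI[of ?c T r t p] a(3) b(3) by simp
qed

text \<open>The constraint of \<open>{t}\<close> gives the upper end; that of its complement,
  subtracted from the total, gives the lower end.\<close>

lemma base_polyhedron_stage_interval:
  assumes "x \<in> base_polyhedron T r" "t \<in> {1..T}"
  shows "x t \<in> stage_interval T r t"
proof -
  have "sum x {t} \<le> r {t}" "sum x ({1..T} - {t}) \<le> r ({1..T} - {t})"
    using assms unfolding base_polyhedron_iff by blast+
  moreover have "sum x {1..T} = x t + sum x ({1..T} - {t})"
    using assms(2) by (simp add: sum.remove)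
  moreover have "sum x {1..T} = r {1..T}" using assms(1) by (simp add: base_polyhedron_iff)
  ultimately show ?thesis unfolding stage_interval_def by simp
qed

lemma proj_set_subset_stage_interval:
  "t \<in> {1..T} \<Longrightarrow> proj_set T r t p \<subseteq> stage_interval T r t"
  using base_polyhedron_stage_interval by (auto simp: proj_set_def)

lemma compact_proj_set:
  assumes t: "t \<in> {1..T}"
  shows "compact (proj_set T r t p)"
proof -
  \<comment> \<open>Coordinates outside \<open>{1..T}\<close> are unconstrained in
    \<open>base_polyhedron\<close>; pinning them to 0 makes the product compact without changing the
    projection to \<open>t\<close>.\<close>
  let ?S = "\<lambda>i. if i \<in> {1..T} then stage_interval T r i else {0}"
  let ?B = "{x. x \<in> base_polyhedron T r \<and> (\<forall>s. s \<in> {1..<t} \<longrightarrow> x s = p s)}"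
  have "closed ?B"
    unfolding base_polyhedron_iff
    by (intro closed_Collect_conj closed_Collect_all closed_Collect_imp open_Collect_const
        closed_Collect_le closed_Collect_eq continuous_intros continuous_on_product_coordinates)
  then have "compact (PiE UNIV ?S \<inter> ?B)"
    by (intro compact_Int_closed compact_PiE_UNIV) (auto simp: stage_interval_def)
  then have "compact ((\<lambda>x. x t) ` (PiE UNIV ?S \<inter> ?B))"
    by (intro compact_continuous_image continuous_on_subset[OF continuous_on_product_coordinates]) auto
  moreover have "(\<lambda>x. x t) ` (PiE UNIV ?S \<inter> ?B) = proj_set T r t p"
  proof (intro equalityI subsetI)
    fix y assume "y \<in> (\<lambda>x. x t) ` (PiE UNIV ?S \<inter> ?B)"
    then show "y \<in> proj_set T r t p" by (auto intro: proj_setI)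
  next
    fix y assume "y \<in> proj_set T r t p"
    then obtain x where x: "x \<in> base_polyhedron T r" "\<forall>s\<in>{1..<t}. x s = p s" "x t = y"
      by (auto simp: proj_set_def)
    let ?x = "\<lambda>i. if i \<in> {1..T} then x i else 0"
    have s: "sum ?x X = sum x X" if "X \<subseteq> {1..T}" for X
      using that by (intro sum.cong) auto
    have "?x \<in> PiE UNIV ?S" using base_polyhedron_stage_interval[OF x(1)] by auto
    moreover have "?x \<in> base_polyhedron T r"
      using x(1) s by (simp add: base_polyhedron_iff)
    moreover have "?x s = p s" if "s \<in> {1..<t}" for s using x(2) that t by simp
    ultimately have "?x \<in> PiE UNIV ?S \<inter> ?B" by blast
    moreover have "y = ?x t" using x t by auto
    ultimately show "y \<in> (\<lambda>x. x t) ` (PiE UNIV ?S \<inter> ?B)" by (rule rev_image_eqI[where f = "\<lambda>x. x t"])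
  qed
  ultimately show ?thesis by simp
qed

section \<open>Tight sets and exchanges in the base polyhedron\<close>

definition tight :: "nat \<Rightarrow> (nat set \<Rightarrow> real) \<Rightarrow> (nat \<Rightarrow> real) \<Rightarrow> nat set \<Rightarrow> bool" where
  "tight T r x X \<longleftrightarrow> X \<subseteq> {1..T} \<and> sum x X = r X"

text \<open>The sum of \<open>x\<close> is modular and \<open>r\<close> is submodular, so the
  nonnegative slacks of union and intersection add up to at most 0.\<close>

lemma tight_Un_Int:
  assumes "submodular_on {1..T} r" "x \<in> base_polyhedron T r" "tight T r x X" "tight T r x Y"
  shows "tight T r x (X \<union> Y)" "tight T r x (X \<inter> Y)"
proof -
  have sub: "X \<subseteq> {1..T}" "Y \<subseteq> {1..T}" using assms by (auto simp: tight_def)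
  then have "finite X" "finite Y" by (auto intro: finite_subset)
  then have "sum x (X \<union> Y) + sum x (X \<inter> Y) = sum x X + sum x Y"
    by (rule sum.union_inter)
  moreover have "r (X \<union> Y) + r (X \<inter> Y) \<le> r X + r Y"
    using assms(1) sub by (auto simp: submodular_on_def)
  moreover have "X \<union> Y \<subseteq> {1..T}" "X \<inter> Y \<subseteq> {1..T}" using sub by auto
  then have "sum x (X \<union> Y) \<le> r (X \<union> Y)" "sum x (X \<inter> Y) \<le> r (X \<inter> Y)"
    using assms(2) unfolding base_polyhedron_iff by blast+
  ultimately show "tight T r x (X \<union> Y)" "tight T r x (X \<inter> Y)"
    using sub assms(3,4) by (auto simp: tight_def)
qed

lemma tight_Union:
  assumes "submodular_on {1..T} r" "x \<in> base_polyhedron T r" "r {} = 0"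
    "finite F" "\<And>X. X \<in> F \<Longrightarrow> tight T r x X"
  shows "tight T r x (\<Union>F)"
  using assms(4,5)
proof (induction F)
  case empty
  then show ?case using assms(3) by (simp add: tight_def)
next
  case (insert X F)
  then show ?case using tight_Un_Int(1)[OF assms(1,2), of X "\<Union>F"] by simp
qed

text \<open>Intersecting with \<open>{1..T}\<close> makes the empty family yield the full set, which
  is tight.\<close>

lemma tight_Inter:
  assumes "submodular_on {1..T} r" "x \<in> base_polyhedron T r"
    "finite F" "\<And>X. X \<in> F \<Longrightarrow> tight T r x X"
  shows "tight T r x ({1..T} \<inter> \<Inter>F)"
  using assms(3,4)
proof (induction F)
  case empty
  then show ?case using assms(2) by (simp add: tight_def base_polyhedron_iff)
next
  case (insert X F)
  then show ?case using tight_Un_Int(2)[OF assms(1,2), of X "{1..T} \<inter> \<Inter>F"]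
    by (simp add: Int_left_commute)
qed

text \<open>Moving mass from \<open>j\<close> to \<open>i\<close> raises only the sums over sets
  that contain \<open>i\<close> but not \<open>j\<close>. There are finitely many of these, each
  with positive slack, so the least slack can be moved.\<close>

lemma base_polyhedron_exchange:
  assumes x: "x \<in> base_polyhedron T r" and ij: "i \<in> {1..T}" "j \<in> {1..T}" "i \<noteq> j"
    and nt: "\<And>X. tight T r x X \<Longrightarrow> i \<in> X \<Longrightarrow> j \<in> X"
  obtains e where "e > 0" "x(i := x i + e, j := x j - e) \<in> base_polyhedron T r"
proof -
  let ?F = "{X. X \<subseteq> {1..T} \<and> i \<in> X \<and> j \<notin> X}"
  \<comment> \<open>The element 1 guarantees a nonempty set for \<open>Min\<close>.\<close>
  let ?G = "insert 1 ((\<lambda>X. r X - sum x X) ` ?F)"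
  have fin: "finite ?G" by (auto intro: finite_subset[of _ "Pow {1..T}"])
  define e where "e = Min ?G"
  have pos: "0 < r X - sum x X" if "X \<in> ?F" for X
  proof -
    have "sum x X \<le> r X" using x that by (auto simp: base_polyhedron_iff)
    moreover have "sum x X \<noteq> r X" using nt[of X] that by (auto simp: tight_def)
    ultimately show ?thesis by simp
  qed
  have "0 < e" using fin pos by (auto simp: e_def)
  have le: "e \<le> r X - sum x X" if "X \<in> ?F" for X
    unfolding e_def using fin that by (intro Min_le) auto
  let ?y = "x(i := x i + e, j := x j - e)"
  have s: "sum ?y X = sum x X + (if i \<in> X then e else 0) - (if j \<in> X then e else 0)"
    if "X \<subseteq> {1..T}" for X
  proof -
    have f: "finite X" using that by (auto intro: finite_subset)
    have "sum ?y X = (\<Sum>k\<in>X. x k + (if k = i then e else 0) - (if k = j then e else 0))"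
      using ij by (intro sum.cong) auto
    also have "\<dots> = sum x X + (if i \<in> X then e else 0) - (if j \<in> X then e else 0)"
      using f by (simp add: sum.distrib sum_subtractf)
    finally show ?thesis .
  qed
  have "?y \<in> base_polyhedron T r"
    unfolding base_polyhedron_iff
  proof safe
    fix X assume X: "X \<subseteq> {1..T}"
    have "sum x X \<le> r X" using x X by (auto simp: base_polyhedron_iff)
    then show "sum ?y X \<le> r X" using le[of X] X \<open>0 < e\<close> unfolding s[OF X] by auto
  next
    show "sum ?y {1..T} = r {1..T}"
      using x ij unfolding s[OF subset_refl] by (simp add: base_polyhedron_iff)
  qed
  then show ?thesis using that \<open>0 < e\<close> by blast
qed

text \<open>If no tight set separated \<open>t\<close> from a later stage \<open>j\<close>, an
  exchange between them would raise \<open>x t\<close> and leave all earlier stages fixed.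
  Intersecting the separating sets over all \<open>j\<close> removes every later stage; for
  \<open>t = T\<close> the result is \<open>{1..T}\<close>.\<close>

lemma tight_if_maximal_stage:
  assumes sub: "submodular_on {1..T} r" and x: "x \<in> base_polyhedron T r" and t: "t \<in> {1..T}"
    and max: "\<And>y. y \<in> proj_set T r t x \<Longrightarrow> y \<le> x t"
  obtains X where "tight T r x X" "t \<in> X" "X \<subseteq> {1..t}"
proof -
  have "\<exists>X. tight T r x X \<and> t \<in> X \<and> j \<notin> X" if j: "j \<in> {t<..T}" for j
  proof (rule ccontr)
    assume "\<not> ?thesis"
    then obtain e where e: "e > 0" "x(t := x t + e, j := x j - e) \<in> base_polyhedron T r"
      using base_polyhedron_exchange[OF x t, of j thesis] j by auto
    then have "x t + e \<in> proj_set T r t x"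
      using proj_setI[of "x(t := x t + e, j := x j - e)" T r t x] j by simp
    then show False using max e by fastforce
  qed
  then obtain X where X: "\<And>j. j \<in> {t<..T} \<Longrightarrow> tight T r x (X j) \<and> t \<in> X j \<and> j \<notin> X j" by metis
  have "tight T r x ({1..T} \<inter> \<Inter>(X ` {t<..T}))"
    using X by (intro tight_Inter[OF sub x]) auto
  moreover have "t \<in> {1..T} \<inter> \<Inter>(X ` {t<..T})" using X t by auto
  moreover have "{1..T} \<inter> \<Inter>(X ` {t<..T}) \<subseteq> {1..t}"
  proof
    fix s assume s: "s \<in> {1..T} \<inter> \<Inter>(X ` {t<..T})"
    then have "\<not> t < s" using X[of s] by auto
    then show "s \<in> {1..t}" using s by simp
  qed
  ultimately show ?thesis using that by blast
qed

text \<open>Dual to the maximal case: the exchange lowers \<open>x t\<close>, and the separating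
  sets are united. For \<open>t = T\<close> the union is empty, which is tight by
  \<open>r0\<close>.\<close>

lemma tight_if_minimal_stage:
  assumes sub: "submodular_on {1..T} r" and r0: "r {} = 0"
    and x: "x \<in> base_polyhedron T r" and t: "t \<in> {1..T}"
    and min: "\<And>y. y \<in> proj_set T r t x \<Longrightarrow> x t \<le> y"
  obtains X where "tight T r x X" "t \<notin> X" "{t<..T} \<subseteq> X"
proof -
  have "\<exists>X. tight T r x X \<and> j \<in> X \<and> t \<notin> X" if j: "j \<in> {t<..T}" for j
  proof (rule ccontr)
    assume "\<not> ?thesis"
    then obtain e where e: "e > 0" "x(j := x j + e, t := x t - e) \<in> base_polyhedron T r"
      using base_polyhedron_exchange[OF x _ t, of j thesis] j by auto
    then have "x t - e \<in> proj_set T r t x"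
      using proj_setI[of "x(j := x j + e, t := x t - e)" T r t x] j by simp
    then show False using min e by fastforce
  qed
  then obtain X where X: "\<And>j. j \<in> {t<..T} \<Longrightarrow> tight T r x (X j) \<and> j \<in> X j \<and> t \<notin> X j" by metis
  have "tight T r x (\<Union>(X ` {t<..T}))"
    using X by (intro tight_Union[OF sub x r0]) auto
  moreover have "t \<notin> \<Union>(X ` {t<..T})" "{t<..T} \<subseteq> \<Union>(X ` {t<..T})" using X by auto
  ultimately show ?thesis using that by blast
qed

text \<open>The polyhedral core of the argument: no costs occur, only the extremality of
  \<open>x\<close> at \<open>t\<close> and at those earlier stages where it lies below another base
  \<open>z\<close>.\<close>

lemma minimal_stage_le:
  assumes sub: "submodular_on {1..T} r" and r0: "r {} = 0"
    and x: "x \<in> base_polyhedron T r" and z: "z \<in> base_polyhedron T r" and t: "t \<in> {1..T}"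
    and min: "\<And>y. y \<in> proj_set T r t x \<Longrightarrow> x t \<le> y"
    and max: "\<And>s y. s \<in> {1..<t} \<Longrightarrow> x s < z s \<Longrightarrow> y \<in> proj_set T r s x \<Longrightarrow> y \<le> x s"
  shows "x t \<le> z t"
proof -
  define A where "A = \<Union>{X. tight T r x X \<and> t \<notin> X}"
  have fin: "finite {X. tight T r x X \<and> t \<notin> X}"
    by (rule finite_subset[of _ "Pow {1..T}"]) (auto simp: tight_def)
  have A: "tight T r x A" unfolding A_def by (rule tight_Union[OF sub x r0 fin]) auto
  have tA: "t \<notin> A" by (auto simp: A_def)
  have later: "{t<..T} \<subseteq> A"
    using tight_if_minimal_stage[OF sub r0 x t min] unfolding A_def by blast
  have AT: "A \<subseteq> {1..T}" using A by (simp add: tight_def)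
  define R where "R = {1..T} - A - {t}"
  have R: "z s \<le> x s" if s: "s \<in> R" for s
  proof (rule ccontr)
    assume "\<not> z s \<le> x s"
    then have lt: "x s < z s" by simp
    have "s \<noteq> t" "s \<in> {1..T}" "s \<notin> A" using s by (auto simp: R_def)
    then have st: "s \<in> {1..<t}" using later
      by (metis atLeastAtMost_iff atLeastLessThan_iff greaterThanAtMost_iff linorder_neqE_nat subsetD)
    \<comment> \<open>Since \<open>s < t\<close>, a tight set within \<open>{1..s}\<close> avoids
      \<open>t\<close> and is therefore part of \<open>A\<close>.\<close>
    obtain X where "tight T r x X" "s \<in> X" "X \<subseteq> {1..s}"
      using tight_if_maximal_stage[OF sub x \<open>s \<in> {1..T}\<close> max[OF st lt]] by blast
    moreover from this st have "t \<notin> X" by auto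
    ultimately show False using \<open>s \<notin> A\<close> unfolding A_def by blast
  qed
  have split: "sum w {1..T} = sum w A + w t + sum w R" for w :: "nat \<Rightarrow> real"
  proof -
    have "sum w {1..T} = sum w ({1..T} - A) + sum w A"
      using AT by (intro sum.subset_diff) auto
    moreover have "sum w ({1..T} - A) = w t + sum w R"
      unfolding R_def using t tA by (intro sum.remove) auto
    ultimately show ?thesis by simp
  qed
  have "sum z A \<le> sum x A"
    using z AT A by (auto simp: base_polyhedron_iff tight_def)
  moreover have "sum z R \<le> sum x R" using R by (rule sum_mono)
  moreover have "sum x {1..T} = sum z {1..T}" using x z by (simp add: base_polyhedron_iff)
  ultimately show ?thesis using split[of x] split[of z] by linarith
qed

section \<open>Minimizers of strictly convex functions of one variable\<close>

lemma strictly_convex_on_linear_diff: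
  assumes "strictly_convex_on D f"
  shows "strictly_convex_on D (\<lambda>y. f y - c * y)"
  using assms unfolding strictly_convex_on_def by (simp add: algebra_simps)

lemma strictly_convex_on_subset:
  "strictly_convex_on D f \<Longrightarrow> S \<subseteq> D \<Longrightarrow> convex S \<Longrightarrow> strictly_convex_on S f"
  unfolding strictly_convex_on_def by blast

lemma strictly_convex_onD:
  "strictly_convex_on S f \<Longrightarrow> x \<in> S \<Longrightarrow> y \<in> S \<Longrightarrow> x \<noteq> y \<Longrightarrow> 0 < u \<Longrightarrow> u < 1 \<Longrightarrow>
    f ((1 - u) * x + u * y) < (1 - u) * f x + u * f y"
  unfolding strictly_convex_on_def by simp

lemma strictly_convex_on_midpoint:
  assumes "strictly_convex_on S f" "y \<in> S" "z \<in> S" "y \<noteq> z"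
  shows "(y + z) / 2 \<in> S" "f ((y + z) / 2) < (f y + f z) / 2"
proof -
  have "f ((1 - 1/2) * y + 1/2 * z) < (1 - 1/2) * f y + 1/2 * f z"
    using assms by (intro strictly_convex_onD) auto
  then show "f ((y + z) / 2) < (f y + f z) / 2" by (simp add: field_simps)
  show "(y + z) / 2 \<in> S"
    using assms convexD[of S y z "1/2" "1/2"]
    by (simp add: strictly_convex_on_def add_divide_distrib)
qed

lemma strictly_convex_arg_min_unique:
  assumes "strictly_convex_on S f" "is_arg_min f (\<lambda>y. y \<in> S) y" "is_arg_min f (\<lambda>y. y \<in> S) z"
  shows "y = z"
proof (rule ccontr)
  assume ne: "y \<noteq> z"
  have yz: "y \<in> S" "z \<in> S" "f y = f z" using assms(2,3) by (force simp: is_arg_min_def)+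
  have "f ((y + z) / 2) < f y" "(y + z) / 2 \<in> S"
    using strictly_convex_on_midpoint[OF assms(1) yz(1,2) ne] yz(3) by simp_all
  then show False using assms(2) by (auto simp: is_arg_min_def)
qed

text \<open>The point \<open>a\<close> may be an endpoint of \<open>D\<close>, so the argument runs
  along a segment issuing from \<open>a\<close> inside \<open>D\<close> and uses only the one-sided
  derivative there.\<close>

lemma strictly_convex_critical_point:
  fixes f :: "real \<Rightarrow> real"
  assumes sc: "strictly_convex_on D f" and a: "a \<in> D" and y: "y \<in> D" "y \<noteq> a"
    and der: "(f has_real_derivative 0) (at a within D)"
  shows "f a < f y"
proof (rule ccontr)
  assume "\<not> f a < f y"
  then have le: "f y \<le> f a" by simp
  have conv: "convex D" using sc by (simp add: strictly_convex_on_def)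
  \<comment> \<open>The midpoint turns the weak inequality \<open>f y \<le> f a\<close> into the
    strict \<open>f m < f a\<close>.\<close>
  define m where "m = (a + y) / 2"
  have mD: "m \<in> D" and ma: "m \<noteq> a" and fm: "f m < f a"
    using strictly_convex_on_midpoint[OF sc a y(1)] y(2) le by (auto simp: m_def)
  \<comment> \<open>This is \<open>f\<close> along the segment minus the slope
    \<open>f m - f a\<close> of its chord. Its derivative at 0 is positive, so the graph of
    \<open>f\<close> would rise above the chord near \<open>a\<close>, against convexity.\<close>
  define \<phi> where "\<phi> = (\<lambda>u. f ((1 - u) * a + u * m) + (f a - f m) * u)"
  have seg: "(1 - u) * a + u * m \<in> D" if "u \<in> {0..1}" for u
    using conv a mD that convexD[of D a m "1 - u" u] by simp
  have "((\<lambda>u. f ((1 - u) * a + u * m)) has_real_derivative 0 * (m - a)) (at 0 within {0..1})"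
  proof (rule DERIV_image_chain[of f 0 "\<lambda>u. (1 - u) * a + u * m" 0, unfolded o_def])
    show "((\<lambda>u. (1 - u) * a + u * m) has_real_derivative m - a) (at 0 within {0..1})"
      by (auto intro!: derivative_eq_intros)
    show "(f has_real_derivative 0) (at ((1 - 0) * a + 0 * m) within (\<lambda>u. (1 - u) * a + u * m) ` {0..1})"
      using seg by (auto intro!: DERIV_subset[OF der])
  qed
  then have "(\<phi> has_real_derivative (f a - f m)) (at 0 within {0..1})"
    unfolding \<phi>_def by (auto intro!: derivative_eq_intros)
  then obtain d where d: "d > 0" "\<And>h. h > 0 \<Longrightarrow> 0 + h \<in> {0..1} \<Longrightarrow> h < d \<Longrightarrow> \<phi> 0 < \<phi> (0 + h)"
    using has_real_derivative_pos_inc_right[of \<phi> "f a - f m" 0 "{0..1}"] fm by auto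
  define h where "h = min (1/2) (d/2)"
  have h: "h > 0" "h < 1" "h < d" using d(1) by (auto simp: h_def)
  have "f a < f ((1 - h) * a + h * m) + (f a - f m) * h"
    using d(2)[of h] h by (simp add: \<phi>_def)
  moreover have "f ((1 - h) * a + h * m) < (1 - h) * f a + h * f m"
    using strictly_convex_onD[OF sc a mD ma[symmetric] h(1,2)] .
  ultimately show False by (simp add: algebra_simps)
qed

text \<open>On the segment from \<open>a\<close> to \<open>y\<close> every point other than
  \<open>y\<close> has a smaller value than \<open>y\<close> when \<open>y \<noteq> a\<close>. Hence
  a constrained minimizer \<open>y\<close> cannot have a point of \<open>S\<close> on its side
  towards \<open>a\<close>.\<close>

lemma arg_min_toward_critical_point:
  fixes f :: "real \<Rightarrow> real"
  assumes sc: "strictly_convex_on D f" and a: "a \<in> D" and amin: "\<And>y. y \<in> D \<Longrightarrow> y \<noteq> a \<Longrightarrow> f a < f y"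
    and S: "S \<subseteq> D" "convex S" and y: "is_arg_min f (\<lambda>y. y \<in> S) y" and z: "z \<in> S"
  shows "z < y \<Longrightarrow> y \<le> a" "y < z \<Longrightarrow> a \<le> y"
proof -
  have no: False if w: "w \<in> S" "w \<noteq> y" "w \<in> closed_segment a y" "y \<noteq> a" for w
  proof -
    have yS: "y \<in> S" using y by (simp add: is_arg_min_def)
    obtain u where u: "0 \<le> u" "u \<le> 1" "w = (1 - u) * a + u * y"
      using w(3) by (auto simp: in_segment)
    have ya: "f a < f y" using amin yS S w by auto
    have u1: "u < 1" using u w(2) by (cases "u = 1") auto
    have "f w < f y"
    proof (cases "u = 0")
      case True
      then show ?thesis using u ya by simp
    next
      case False
      then have "f w < (1 - u) * f a + u * f y"
        using sc a yS S u u1 w unfolding strictly_convex_on_def by (auto simp: subset_iff)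
      also have "\<dots> \<le> (1 - u) * f y + u * f y" using ya u1 by simp
      finally show ?thesis by (simp add: algebra_simps)
    qed
    then show False using y w(1) by (auto simp: is_arg_min_def)
  qed
  have yS: "y \<in> S" using y by (simp add: is_arg_min_def)
  have int: "w \<in> S" if "w \<in> closed_segment z y" for w
    using that S(2) z yS by (meson closed_segment_subset subsetD)
  show "y \<le> a" if "z < y"
  proof (rule ccontr)
    assume "\<not> y \<le> a"
    then show False
      \<comment> \<open>Of \<open>z\<close> and \<open>a\<close>, the one nearer to \<open>y\<close>
        lies both in \<open>S\<close> and on the segment from \<open>a\<close> to
        \<open>y\<close>.\<close>
      using no[of "max z a"] int[of "max z a"] that
      by (cases "z \<le> a") (auto simp: closed_segment_eq_real_ivl)
  qed
  show "a \<le> y" if "y < z"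
  proof (rule ccontr)
    assume "\<not> a \<le> y"
    then show False
      using no[of "min z a"] int[of "min z a"] that
      by (cases "a \<le> z") (auto simp: closed_segment_eq_real_ivl)
  qed
qed

text \<open>Justifies the definite descriptions of the local and online solutions: compactness gives
  existence, strict convexity uniqueness.\<close>

lemma the_arg_min:
  assumes "strictly_convex_on D f" "continuous_on D f" "S \<subseteq> D" "convex S" "compact S" "S \<noteq> {}"
  shows "is_arg_min f (\<lambda>y. y \<in> S) (THE y. is_arg_min f (\<lambda>y. y \<in> S) y)"
proof -
  obtain y where "y \<in> S" "\<And>z. z \<in> S \<Longrightarrow> f y \<le> f z"
    using continuous_attains_inf[of S f] assms continuous_on_subset by blast
  then have y: "is_arg_min f (\<lambda>y. y \<in> S) y" by (force simp: is_arg_min_def)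
  have "strictly_convex_on S f"
    using strictly_convex_on_subset assms by blast
  then show ?thesis
    using theI[of "is_arg_min f (\<lambda>y. y \<in> S)", OF y] strictly_convex_arg_min_unique y by blast
qed

section \<open>Local and online solutions\<close>

lemma strictly_convex_local_lagrangian:
  "I_sub T r D f \<Longrightarrow> t \<in> {1..T} \<Longrightarrow> strictly_convex_on (D t) (local_lagrangian T f \<mu> l t)"
  unfolding local_lagrangian_def I_sub_def by (intro strictly_convex_on_linear_diff) blast

lemma continuous_on_local_lagrangian:
  "I_sub T r D f \<Longrightarrow> t \<in> {1..T} \<Longrightarrow> continuous_on (D t) (local_lagrangian T f \<mu> l t)"
  unfolding local_lagrangian_def I_sub_def
  by (intro continuous_intros differentiable_imp_continuous_on) blast

lemma proj_set_subset_domain: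
  "I_sub T r D f \<Longrightarrow> t \<in> {1..T} \<Longrightarrow> proj_set T r t p \<subseteq> D t"
  using proj_set_subset_stage_interval unfolding I_sub_def by blast

text \<open>Nonemptiness stays a hypothesis here, because it depends on the feasibility of the
  earlier online decisions, which is proved by induction below.\<close>

lemma online_solution_arg_min:
  assumes "I_sub T r D f" "t \<in> {1..T}" "proj_set T r t (online_solution T r f \<mu> l) \<noteq> {}"
  shows "is_arg_min (local_lagrangian T f \<mu> l t)
    (\<lambda>y. y \<in> proj_set T r t (online_solution T r f \<mu> l)) (online_solution T r f \<mu> l t)"
  using the_arg_min[OF strictly_convex_local_lagrangian[OF assms(1,2)]
      continuous_on_local_lagrangian[OF assms(1,2)] proj_set_subset_domain[OF assms(1,2)]
      convex_proj_set compact_proj_set[OF assms(2)] assms(3)]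
  unfolding online_solution.simps[of T r f \<mu> l t] .

lemma local_solution_arg_min:
  assumes I: "I_sub T r D f" and t: "t \<in> {1..T}" and ne: "stage_interval T r t \<noteq> {}"
  shows "is_arg_min (local_lagrangian T f \<mu> l t)
    (\<lambda>y. y \<in> stage_interval T r t) (local_solution T r f \<mu> l t)"
proof -
  have "stage_interval T r t \<subseteq> D t" using I t by (simp add: I_sub_def)
  then show ?thesis
    unfolding local_solution_def
    using I t ne
    by (intro the_arg_min[OF strictly_convex_local_lagrangian[OF I t] continuous_on_local_lagrangian[OF I t]])
      (auto simp: stage_interval_def)
qed

text \<open>A base extending the first \<open>t\<close> decisions shows that the next projected set
  is nonempty; the minimizer chosen there again extends to a base. The given \<open>z\<close> starts
  the induction.\<close>

lemma online_solution_prefix_feasible: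
  assumes "I_sub T r D f" "z \<in> base_polyhedron T r" "t \<le> T"
  shows "\<exists>x\<in>base_polyhedron T r. \<forall>s\<in>{1..t}. x s = online_solution T r f \<mu> l s"
  using assms(3)
proof (induction t)
  case 0
  then show ?case using assms(2) by auto
next
  case (Suc t)
  let ?p = "online_solution T r f \<mu> l"
  obtain x where "x \<in> base_polyhedron T r" "\<forall>s\<in>{1..t}. x s = ?p s"
    using Suc.IH Suc.prems by fastforce
  then have "x (Suc t) \<in> proj_set T r (Suc t) ?p" by (intro proj_setI) auto
  then have "?p (Suc t) \<in> proj_set T r (Suc t) ?p"
    using online_solution_arg_min[OF assms(1), of "Suc t"] Suc.prems by (auto simp: is_arg_min_def)
  then obtain y where "y \<in> base_polyhedron T r" "\<forall>s\<in>{1..<Suc t}. y s = ?p s" "y (Suc t) = ?p (Suc t)"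
    by (auto simp: proj_set_def)
  then show ?case by (metis atLeastAtMost_iff atLeastLessThan_iff le_SucE less_Suc_eq_le)
qed

lemma online_solution_in_base_polyhedron:
  assumes "I_sub T r D f" "z \<in> base_polyhedron T r"
  shows "online_solution T r f \<mu> l \<in> base_polyhedron T r"
proof -
  obtain x where x: "x \<in> base_polyhedron T r" "\<forall>s\<in>{1..T}. x s = online_solution T r f \<mu> l s"
    using online_solution_prefix_feasible[OF assms order_refl] by blast
  have "sum (online_solution T r f \<mu> l) X = sum x X" if "X \<subseteq> {1..T}" for X
    using that x(2) by (intro sum.cong) auto
  then show ?thesis using x(1) by (simp add: base_polyhedron_iff)
qed

text \<open>Once the earlier decisions agree, the local solution lies in the projected set. As it
  minimizes over the larger stage interval, it is also the unique minimizer over that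
  subset.\<close>

lemma online_solution_eq_local_solution:
  assumes I: "I_sub T r D f" and feas: "local_solution T r f \<mu> l \<in> base_polyhedron T r"
  shows "t \<in> {1..T} \<Longrightarrow> online_solution T r f \<mu> l t = local_solution T r f \<mu> l t"
proof (induction t rule: less_induct)
  case (less t)
  let ?L = "local_lagrangian T f \<mu> l t"
  let ?p = "online_solution T r f \<mu> l" and ?q = "local_solution T r f \<mu> l"
  have "?q s = ?p s" if "s \<in> {1..<t}" for s using less that by auto
  then have q: "?q t \<in> proj_set T r t ?p"
    using feas by (intro proj_setI) auto
  then have "is_arg_min ?L (\<lambda>y. y \<in> proj_set T r t ?p) (?q t)"
    using local_solution_arg_min[OF I less.prems] proj_set_subset_stage_interval[OF less.prems, of r ?p]
    unfolding is_arg_min_def by blast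
  moreover have "is_arg_min ?L (\<lambda>y. y \<in> proj_set T r t ?p) (?p t)"
    using online_solution_arg_min[OF I less.prems] q by blast
  moreover have "strictly_convex_on (proj_set T r t ?p) ?L"
    using strictly_convex_on_subset[OF strictly_convex_local_lagrangian[OF I less.prems]
        proj_set_subset_domain[OF I less.prems] convex_proj_set] .
  ultimately show ?case using strictly_convex_arg_min_unique by blast
qed

section \<open>Unconstrained minimizers and their dependence on the multipliers\<close>

lemma grad_inv_arg_min:
  assumes I: "I_sub T r D f" and t: "t \<in> {1..T}" and nu: "nu T \<mu> l t \<in> grad (D t) (f t) ` D t"
  defines "a \<equiv> grad_inv (D t) (f t) (nu T \<mu> l t)"
  shows "a \<in> D t" "\<And>y. y \<in> D t \<Longrightarrow> y \<noteq> a \<Longrightarrow> local_lagrangian T f \<mu> l t a < local_lagrangian T f \<mu> l t y"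
proof -
  show a: "a \<in> D t" unfolding a_def grad_inv_def using nu by (rule inv_into_into)
  have ga: "grad (D t) (f t) a = nu T \<mu> l t"
    unfolding a_def grad_inv_def using nu by (rule f_inv_into_f)
  have "f t differentiable (at a within D t)"
    using I t a by (auto simp: I_sub_def differentiable_on_def)
  then have "(f t has_vector_derivative nu T \<mu> l t) (at a within D t)"
    using ga by (simp add: vector_derivative_works grad_def)
  then have "(f t has_real_derivative nu T \<mu> l t) (at a within D t)"
    by (simp add: has_real_derivative_iff_has_vector_derivative)
  then have der: "(local_lagrangian T f \<mu> l t has_real_derivative 0) (at a within D t)"
    unfolding local_lagrangian_def by (auto intro!: derivative_eq_intros)
  show "local_lagrangian T f \<mu> l t a < local_lagrangian T f \<mu> l t y" if "y \<in> D t" "y \<noteq> a" for y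
    using strictly_convex_critical_point[OF strictly_convex_local_lagrangian[OF I t] a that der] .
qed

lemma nu_antimono:
  assumes "\<forall>X\<in>multiplier_sets T. \<mu> X \<le> \<mu>' X" "l \<le> l'"
  shows "nu T \<mu>' l' t \<le> nu T \<mu> l t"
proof -
  have "(\<Sum>X\<in>{X\<in>multiplier_sets T. t \<in> X}. \<mu> X) \<le> (\<Sum>X\<in>{X\<in>multiplier_sets T. t \<in> X}. \<mu>' X)"
    using assms(1) by (intro sum_mono) auto
  then show ?thesis using assms(2) by (simp add: nu_def)
qed

text \<open>Adding the two strict minimality inequalities cancels \<open>f t\<close> and leaves a
  product of differences of contradictory sign; monotonicity of the derivative is not
  invoked.\<close>

lemma grad_inv_mono:
  assumes I: "I_sub T r D f" and t: "t \<in> {1..T}"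
    and nu: "nu T \<mu> l t \<in> grad (D t) (f t) ` D t" "nu T \<mu>' l' t \<in> grad (D t) (f t) ` D t"
    and le: "nu T \<mu>' l' t \<le> nu T \<mu> l t"
  shows "grad_inv (D t) (f t) (nu T \<mu>' l' t) \<le> grad_inv (D t) (f t) (nu T \<mu> l t)"
    (is "?b \<le> ?a")
proof (rule ccontr)
  assume "\<not> ?b \<le> ?a"
  then have lt: "?a < ?b" by simp
  note a = grad_inv_arg_min[OF I t nu(1)] and b = grad_inv_arg_min[OF I t nu(2)]
  have "(nu T \<mu> l t - nu T \<mu>' l' t) * (?b - ?a) < 0"
    using a(2)[OF b(1)] b(2)[OF a(1)] lt by (simp add: local_lagrangian_def algebra_simps)
  moreover have "(nu T \<mu> l t - nu T \<mu>' l' t) * (?b - ?a) \<ge> 0"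
    using le lt by (intro mult_nonneg_nonneg) auto
  ultimately show False by simp
qed

theorem theorem1:
  fixes T :: nat
    and r :: "nat set \<Rightarrow> real"
    and D :: "nat \<Rightarrow> real set"
    and f :: "nat \<Rightarrow> real \<Rightarrow> real"
    and \<mu>_opt \<mu>_hat :: "nat set \<Rightarrow> real"
    and l_opt l_hat :: real
  assumes "I_sub T r D f"
    and "optimal_multipliers T r f \<mu>_opt l_opt"
    and "\<forall>X\<in>multiplier_sets T. \<mu>_hat X \<le> \<mu>_opt X"
    and "l_hat \<le> l_opt"
    and "\<forall>t\<in>{1..T}. nu T \<mu>_hat l_hat t \<in> grad (D t) (f t) ` D t"
    and "\<forall>t\<in>{1..T}. nu T \<mu>_opt l_opt t \<in> grad (D t) (f t) ` D t"
  shows "(\<Sum>t\<in>{1..T}. f t (online_solution T r f \<mu>_hat l_hat t))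
           - (\<Sum>t\<in>{1..T}. f t (online_solution T r f \<mu>_opt l_opt t))
         \<le> (\<Sum>t\<in>{1..T}. f t (grad_inv (D t) (f t) (nu T \<mu>_hat l_hat t)))
           - (\<Sum>t\<in>{1..T}. f t (grad_inv (D t) (f t) (nu T \<mu>_opt l_opt t)))"
proof -
  note I = assms(1)
  define x where "x = online_solution T r f \<mu>_hat l_hat"
  define z where "z = local_solution T r f \<mu>_opt l_opt"
  define a where "a t = grad_inv (D t) (f t) (nu T \<mu>_hat l_hat t)" for t
  define b where "b t = grad_inv (D t) (f t) (nu T \<mu>_opt l_opt t)" for t
  let ?C = "stage_interval T r"
  have sub: "submodular_on {1..T} r" and r0: "r {} = 0" using I by (auto simp: I_sub_def)
  have zB: "z \<in> base_polyhedron T r"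
    using assms(2) by (simp add: z_def optimal_multipliers_def optimal_solution_def is_arg_min_def)
  have xB: "x \<in> base_polyhedron T r"
    unfolding x_def using online_solution_in_base_polyhedron[OF I zB] .
  have ab: "b t \<le> a t" "a t \<in> D t" "b t \<in> D t" if "t \<in> {1..T}" for t
    unfolding a_def b_def
    using grad_inv_mono[OF I that _ _ nu_antimono[OF assms(3,4)]] grad_inv_arg_min(1)[OF I that]
      assms(5,6) that by auto
  \<comment> \<open>Another feasible value \<open>w\<close> on one side of \<open>x t\<close> forces
    \<open>a t\<close> to lie weakly on the opposite side. Read contrapositively, this yields the
    extremality of \<open>x t\<close> required by \<open>minimal_stage_le\<close>.\<close>
  have x_toward: "w < x t \<Longrightarrow> x t \<le> a t" "x t < w \<Longrightarrow> a t \<le> x t"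
    if t: "t \<in> {1..T}" and w: "w \<in> proj_set T r t x" for t w
    unfolding a_def using assms(5) t w
      arg_min_toward_critical_point[OF strictly_convex_local_lagrangian[OF I t] grad_inv_arg_min[OF I t]
        proj_set_subset_domain[OF I t] convex_proj_set online_solution_arg_min[OF I t]]
    unfolding x_def by blast+
  have CD: "?C t \<subseteq> D t" if "t \<in> {1..T}" for t using I that by (simp add: I_sub_def)
  have xC: "x t \<in> ?C t" "z t \<in> ?C t" if "t \<in> {1..T}" for t
    using that base_polyhedron_stage_interval xB zB by blast+
  \<comment> \<open>The same for \<open>z\<close> over the full stage interval, where
    \<open>x t\<close> serves as the other value \<open>w\<close>.\<close>
  have z_toward: "w < z t \<Longrightarrow> z t \<le> b t" "z t < w \<Longrightarrow> b t \<le> z t"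
    if t: "t \<in> {1..T}" and w: "w \<in> ?C t" for t w
  proof -
    have "convex (?C t)" by (simp add: stage_interval_def)
    then show "w < z t \<Longrightarrow> z t \<le> b t" "z t < w \<Longrightarrow> b t \<le> z t"
      unfolding b_def using assms(6) t w
        arg_min_toward_critical_point[OF strictly_convex_local_lagrangian[OF I t]
          grad_inv_arg_min[OF I t] CD[OF t] _ local_solution_arg_min[OF I t]]
      unfolding z_def by blast+
  qed
  have key: "x t \<le> a t" if t: "t \<in> {1..T}" and gt: "z t < x t" for t
  proof (rule ccontr)
    assume not_le: "\<not> x t \<le> a t"
    have "x t \<le> z t"
    proof (rule minimal_stage_le[OF sub r0 xB zB t])
      fix y assume "y \<in> proj_set T r t x"
      then show "x t \<le> y" using x_toward(1)[OF t] not_le by force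
    next
      fix s y assume s: "s \<in> {1..<t}" and lt: "x s < z s" and y: "y \<in> proj_set T r s x"
      have s': "s \<in> {1..T}" using s t by auto
      have "z s \<le> b s" using z_toward(1)[OF s' xC(1)[OF s'] lt] .
      then have "x s < a s" using lt ab(1)[OF s'] by simp
      then show "y \<le> x s" using x_toward(2)[OF s' y] by force
    qed
    then show False using gt by simp
  qed
  have stage: "f t (x t) - f t (z t) \<le> f t (a t) - f t (b t)" if t: "t \<in> {1..T}" for t
  proof -
    have mono: "f t v \<le> f t w" if "v \<in> D t" "w \<in> D t" "v \<le> w" for v w
      using I t that by (auto simp: I_sub_def mono_on_def)
    have D: "x t \<in> D t" "z t \<in> D t" using xC[OF t] CD[OF t] by auto
    show ?thesis
    proof (cases "x t \<le> z t")
      \<comment> \<open>The left side is at most 0 and the right side at least 0, the latter because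
        \<open>b t \<le> a t\<close>.\<close>
      case True
      then have "f t (x t) \<le> f t (z t)" using mono D by blast
      moreover have "f t (b t) \<le> f t (a t)" using mono ab[OF t] by blast
      ultimately show ?thesis by simp
    next
      \<comment> \<open>Here \<open>x\<close> is compared with \<open>a\<close>, and
        \<open>z\<close> with \<open>b\<close>, separately.\<close>
      case False
      then have "x t \<le> a t" "b t \<le> z t" using key[OF t] z_toward(2)[OF t xC(1)[OF t]] by auto
      then have "f t (x t) \<le> f t (a t)" "f t (b t) \<le> f t (z t)" using mono ab[OF t] D by blast+
      then show ?thesis by simp
    qed
  qed
  have "(\<Sum>t\<in>{1..T}. f t (x t)) - (\<Sum>t\<in>{1..T}. f t (z t))
      \<le> (\<Sum>t\<in>{1..T}. f t (a t)) - (\<Sum>t\<in>{1..T}. f t (b t))"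
    unfolding sum_subtractf[symmetric] using stage by (rule sum_mono)
  moreover have "(\<Sum>t\<in>{1..T}. f t (online_solution T r f \<mu>_opt l_opt t)) = (\<Sum>t\<in>{1..T}. f t (z t))"
    using online_solution_eq_local_solution[OF I zB[unfolded z_def]] by (simp add: z_def)
  ultimately show ?thesis unfolding x_def a_def b_def by simp
qed

end
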